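(* Let $n$ be a positive integer, let $\mathcal{C}$ be a uniformly random integrated coloring of the path $P_n$, and let $k$ be an integer between $\lceil (n-1)/2\rceil$ and $n-1$. Then \[\Pr[\mathrm{mix}(\mathcal{C})=k] = \frac{2\binom{k-1}{n-k-1}}{\mathrm{ic}(P_n)}.\]
   Context: Let $G=(V,E)$ be a finite labeled graph. A coloring of $G$ is an arbitrary map $\mathcal{C}: V \to \{\text{black},\text{white}\}$. An edge is balanced if its endpoints have different colors. The mixing number $\mathrm{mix}(\mathcal{C})$ is the number of balanced edges of $G$. For a vertex $v$, $\mathrm{mix}(v)$ is the number of balanced edges incident to $v$. A vertex $v$ is integrated if $\mathrm{mix}(v)\geq \frac12\deg(v)$, and $\mathcal{C}$ is integrated if every vertex is integrated. $\mathrm{ic}(G)$ is the number of integrated colorings of $G$. The path $P_n$ has vertices $1,\dots,n$ and edges $\{i,i+1\}$ for $1\le i\le n-1$. *)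

theory Defs
  imports "HOL-Probability.Probability"
begin

type_synonym 'a graph = "'a set \<times> 'a set set"

abbreviation verts :: "'a graph \<Rightarrow> 'a set" where
  "verts G \<equiv> fst G"

abbreviation edges :: "'a graph \<Rightarrow> 'a set set" where
  "edges G \<equiv> snd G"

definition finite_graph :: "'a graph \<Rightarrow> bool" where
  "finite_graph G \<longleftrightarrow> finite (verts G) \<and>
     (\<forall>e\<in>edges G. \<exists>u\<in>verts G. \<exists>v\<in>verts G. u \<noteq> v \<and> e = {u, v})"

datatype color = Black | White

text \<open>Maps on the vertex set are represented by extensional functions, so that
  each coloring of the graph is counted exactly once.\<close>

definition colorings :: "'a graph \<Rightarrow> ('a \<Rightarrow> color) set" where
  "colorings G = verts G \<rightarrow>\<^sub>E UNIV"

definition balanced :: "('a \<Rightarrow> color) \<Rightarrow> 'a set \<Rightarrow> bool" where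
  "balanced C e \<longleftrightarrow> (\<exists>u v. e = {u, v} \<and> C u \<noteq> C v)"

definition mix :: "'a graph \<Rightarrow> ('a \<Rightarrow> color) \<Rightarrow> nat" where
  "mix G C = card {e \<in> edges G. balanced C e}"

definition mix_at :: "'a graph \<Rightarrow> ('a \<Rightarrow> color) \<Rightarrow> 'a \<Rightarrow> nat" where
  "mix_at G C v = card {e \<in> edges G. v \<in> e \<and> balanced C e}"

definition deg :: "'a graph \<Rightarrow> 'a \<Rightarrow> nat" where
  "deg G v = card {e \<in> edges G. v \<in> e}"

definition integrated_at :: "'a graph \<Rightarrow> ('a \<Rightarrow> color) \<Rightarrow> 'a \<Rightarrow> bool" where
  "integrated_at G C v \<longleftrightarrow> real (mix_at G C v) \<ge> 1 / 2 * real (deg G v)"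

definition integrated :: "'a graph \<Rightarrow> ('a \<Rightarrow> color) \<Rightarrow> bool" where
  "integrated G C \<longleftrightarrow> (\<forall>v\<in>verts G. integrated_at G C v)"

definition integrated_colorings :: "'a graph \<Rightarrow> ('a \<Rightarrow> color) set" where
  "integrated_colorings G = {C \<in> colorings G. integrated G C}"

definition ic :: "'a graph \<Rightarrow> nat" where
  "ic G = card (integrated_colorings G)"

definition path_graph :: "nat \<Rightarrow> nat graph" where
  "path_graph n = ({1..n}, {{i, i + 1} | i. 1 \<le> i \<and> i \<le> n - 1})"

lemma finite_graph_path_graph: "finite_graph (path_graph n)"
proof -
  have "\<exists>u\<in>{1..n}. \<exists>v\<in>{1..n}. u \<noteq> v \<and> {i, i + 1} = {u, v}" if "1 \<le> i" "i \<le> n - 1" for i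
    using that by (intro bexI[of _ i] bexI[of _ "i + 1"]) auto
  then show ?thesis
    unfolding finite_graph_def path_graph_def by auto
qed

text \<open>The library's uniform distribution \<^const>\<open>pmf_of_set\<close> is only meaningful on
  finite nonempty sets; the next two facts guarantee this for integrated colorings
  of paths.\<close>

lemma finite_integrated_colorings:
  assumes "finite_graph G"
  shows "finite (integrated_colorings G)"
proof -
  have "(UNIV :: color set) = {Black, White}"
    using color.exhaust by auto
  then have "finite (UNIV :: color set)"
    by (rule ssubst) simp
  then have "finite (colorings G)"
    using assms unfolding colorings_def finite_graph_def by (intro finite_PiE) auto
  then show ?thesis
    unfolding integrated_colorings_def by simp
qed

lemma integrated_colorings_path_graph_nonempty:
  "integrated_colorings (path_graph n) \<noteq> {}"
proof -
  define C where "C = restrict (\<lambda>i. if even i then Black else White) {1..n}"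
  have bal: "balanced C e" if "e \<in> edges (path_graph n)" for e
  proof -
    from that obtain i where "e = {i, i + 1}" "1 \<le> i" "i \<le> n - 1"
      unfolding path_graph_def by auto
    moreover from this have "C i \<noteq> C (i + 1)"
      unfolding C_def by auto
    ultimately show ?thesis
      unfolding balanced_def by blast
  qed
  have "mix_at (path_graph n) C v = deg (path_graph n) v" for v
    unfolding mix_at_def deg_def using bal by (intro arg_cong[where f = card]) auto
  then have "integrated (path_graph n) C"
    unfolding integrated_def integrated_at_def by simp
  moreover have "C \<in> colorings (path_graph n)"
    unfolding C_def colorings_def path_graph_def by auto
  ultimately show ?thesis
    unfolding integrated_colorings_def by blast
qed

end

theory Submission
  imports Defs
begin

text \<open>
  A coloring of the path on \<open>1, \<dots>, n\<close> is the same thing as the color of vertex \<open>1\<close> together with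
  the set \<open>U\<close> of unbalanced edges, edge \<open>{i, i + 1}\<close> being named by its left endpoint \<open>i\<close>: walking
  along the path, \<open>U\<close> says at each step whether the color is kept or flipped. In these terms the
  mixing number is \<open>n - 1 - card U\<close>. An end vertex has a single edge, so it is integrated iff that
  edge is balanced; an inner vertex is integrated iff at least one of its two edges is. Hence the
  coloring is integrated iff \<open>U\<close> avoids the two extreme edges \<open>1\<close> and \<open>n - 1\<close> and contains no two
  consecutive numbers (\<open>integrated_path_iff\<close>).

  The integrated colorings with mixing number \<open>k\<close> therefore correspond to a free choice of the
  first color and a set of \<open>j = n - 1 - k\<close> pairwise non-consecutive numbers among the \<open>n - 3\<close> inner
  edges. There are \<open>(n - 2 - j) choose j = (k - 1) choose (n - k - 1)\<close> such sets
  (\<open>card_sparse_subsets\<close>), which gives the numerator of the claimed probability. For \<open>n < 3\<close> there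
  are no inner edges, only \<open>U = {}\<close> is possible, and the binomial coefficient is \<open>1\<close>; for \<open>n = 1\<close>
  it is the generalized coefficient of \<open>-1\<close> over \<open>0\<close>.
\<close>

section \<open>Sets without consecutive elements\<close>

definition nonconsecutive :: "nat set \<Rightarrow> bool" where
  "nonconsecutive U \<longleftrightarrow> (\<forall>i\<in>U. Suc i \<notin> U)"

definition sparse_subsets :: "nat \<Rightarrow> nat \<Rightarrow> nat \<Rightarrow> nat set set" where
  "sparse_subsets a m j = {U. U \<subseteq> {a..<a + m} \<and> nonconsecutive U \<and> card U = j}"

lemma finite_sparse_subsets: "finite (sparse_subsets a m j)"
  by (rule finite_subset[of _ "Pow {a..<a + m}"]) (auto simp: sparse_subsets_def)

lemma sparse_subsets_0: "sparse_subsets a m 0 = {{}}"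
proof -
  have "U = {}" if "U \<subseteq> {a..<a + m}" "card U = 0" for U
    using that finite_subset[OF that(1)] by simp
  then show ?thesis
    by (auto simp: sparse_subsets_def nonconsecutive_def)
qed

text \<open>Split on whether the largest available number belongs to the set; if it does, its predecessor
  must not, and the rest is a sparse subset of an interval shorter by two.\<close>

lemma sparse_subsets_Suc_Suc:
  "sparse_subsets a (Suc (Suc m)) (Suc j) =
     sparse_subsets a (Suc m) (Suc j) \<union> insert (a + Suc m) ` sparse_subsets a m j"
  (is "?L = ?A \<union> ?B")
proof (intro equalityI subsetI)
  fix U assume U: "U \<in> ?L"
  then have sub: "U \<subseteq> {a..<a + Suc (Suc m)}" and sp: "nonconsecutive U" and cU: "card U = Suc j"
    by (auto simp: sparse_subsets_def)
  have fin: "finite U" using sub finite_subset by blast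
  show "U \<in> ?A \<union> ?B"
  proof (cases "a + Suc m \<in> U")
    case True
    have "a + m \<notin> U" using sp True by (auto simp: nonconsecutive_def)
    then have "U - {a + Suc m} \<subseteq> {a..<a + m}"
      using sub by (force simp: less_Suc_eq)
    moreover have "nonconsecutive (U - {a + Suc m})" using sp by (auto simp: nonconsecutive_def)
    moreover have "card (U - {a + Suc m}) = j" using True cU fin by simp
    ultimately have "U - {a + Suc m} \<in> sparse_subsets a m j"
      by (simp add: sparse_subsets_def)
    moreover have "U = insert (a + Suc m) (U - {a + Suc m})" using True by auto
    ultimately show ?thesis by blast
  next
    case False
    then have "U \<subseteq> {a..<a + Suc m}"
      using sub by (force simp: less_Suc_eq)
    then show ?thesis using sp cU by (simp add: sparse_subsets_def)
  qed
next
  fix U assume "U \<in> ?A \<union> ?B"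
  then show "U \<in> ?L"
  proof
    assume "U \<in> ?A"
    then show ?thesis by (auto simp: sparse_subsets_def)
  next
    assume "U \<in> ?B"
    then obtain W where W: "U = insert (a + Suc m) W" "W \<subseteq> {a..<a + m}" "nonconsecutive W" "card W = j"
      by (auto simp: sparse_subsets_def)
    have "finite W" using W(2) finite_subset by blast
    moreover have "a + Suc m \<notin> W" using W(2) by auto
    moreover have "nonconsecutive U"
      using W(1-3) by (auto simp: nonconsecutive_def subset_iff)
    ultimately show ?thesis
      using W by (auto simp: sparse_subsets_def)
  qed
qed

lemma card_sparse_subsets_Suc_Suc:
  "card (sparse_subsets a (Suc (Suc m)) (Suc j)) =
     card (sparse_subsets a (Suc m) (Suc j)) + card (sparse_subsets a m j)"
proof -
  have "inj_on (insert (a + Suc m)) (sparse_subsets a m j)"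
  proof (rule inj_onI)
    fix X Y assume XY: "X \<in> sparse_subsets a m j" "Y \<in> sparse_subsets a m j"
      and eq: "insert (a + Suc m) X = insert (a + Suc m) Y"
    have "a + Suc m \<notin> X" "a + Suc m \<notin> Y" using XY by (auto simp: sparse_subsets_def)
    with eq show "X = Y" by (simp add: insert_ident)
  qed
  moreover have "sparse_subsets a (Suc m) (Suc j) \<inter> insert (a + Suc m) ` sparse_subsets a m j = {}"
    by (auto simp: sparse_subsets_def)
  ultimately show ?thesis
    by (simp only: sparse_subsets_Suc_Suc card_Un_disjoint finite_sparse_subsets finite_imageI
        card_image)
qed

text \<open>The recursion above is Pascal's rule on the right-hand side. Truncated subtraction does no
  harm: for \<open>j > m + 1\<close> both sides are \<open>0\<close>.\<close>

lemma card_sparse_subsets: "card (sparse_subsets a m j) = (m + 1 - j) choose j"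
proof (induction m arbitrary: j rule: induct_nat_012)
  case 0
  show ?case
  proof (cases j)
    case (Suc i)
    then have "sparse_subsets a 0 j = {}" by (auto simp: sparse_subsets_def)
    then show ?thesis using Suc by simp
  qed (simp add: sparse_subsets_0)
next
  case 1
  show ?case
  proof (cases j)
    case (Suc i)
    have "sparse_subsets a (Suc 0) j = (if i = 0 then {{a}} else {})"
      using Suc by (auto simp: sparse_subsets_def nonconsecutive_def subset_singleton_iff)
    then show ?thesis using Suc by (cases i) auto
  qed (simp add: sparse_subsets_0)
next
  case (ge2 m)
  show ?case
  proof (cases j)
    case (Suc i)
    show ?thesis
    proof (cases "i \<le> m + 1")
      case True
      then have "m + 2 - i = Suc (m + 1 - i)" by simp
      then show ?thesis
        using Suc ge2 by (simp add: card_sparse_subsets_Suc_Suc)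
    next
      case False
      then show ?thesis
        using Suc ge2 by (simp add: card_sparse_subsets_Suc_Suc)
    qed
  qed (simp add: sparse_subsets_0)
qed


section \<open>Colorings of a path by their unbalanced edges\<close>

definition unbalanced_steps :: "nat \<Rightarrow> (nat \<Rightarrow> color) \<Rightarrow> nat set" where
  "unbalanced_steps n C = {i \<in> {1..n - 1}. C i = C (i + 1)}"

lemma UNIV_color: "(UNIV :: color set) = {Black, White}"
  using color.exhaust by auto

lemma finite_UNIV_color: "finite (UNIV :: color set)"
  by (subst UNIV_color) simp

lemma card_UNIV_color: "card (UNIV :: color set) = 2"
  by (subst UNIV_color) simp

text \<open>Only injectivity needs an argument, namely induction along the path; surjectivity follows
  because both sides have \<open>2 ^ n\<close> elements.\<close>

lemma bij_betw_colorings_path: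
  assumes "n \<ge> 1"
  shows "bij_betw (\<lambda>C. (C 1, unbalanced_steps n C)) (colorings (path_graph n))
           (UNIV \<times> Pow {1..n - 1})"
proof -
  let ?f = "\<lambda>C. (C 1, unbalanced_steps n C)"
  let ?S = "colorings (path_graph n)" and ?T = "(UNIV :: color set) \<times> Pow {1..n - 1}"
  have S: "?S = {1..n} \<rightarrow>\<^sub>E UNIV" by (simp add: colorings_def path_graph_def)
  have inj: "inj_on ?f ?S"
  proof (rule inj_onI)
    fix C D assume CD: "C \<in> ?S" "D \<in> ?S" and eq: "?f C = ?f D"
    have same: "C i = C (i + 1) \<longleftrightarrow> D i = D (i + 1)" if "1 \<le> i" "i \<le> n - 1" for i
    proof -
      have "i \<in> unbalanced_steps n C \<longleftrightarrow> i \<in> unbalanced_steps n D" using eq by simp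
      then show ?thesis using that by (simp add: unbalanced_steps_def)
    qed
    have "C i = D i" if "1 \<le> i" "i \<le> n" for i
      using that
    proof (induction i rule: dec_induct)
      case base
      then show ?case using eq by simp
    next
      case (step i)
      then have "C i = D i" "C i = C (i + 1) \<longleftrightarrow> D i = D (i + 1)"
        using same[of i] by simp_all
      \<comment> \<open>with only two colors, differing from the same color forces equality\<close>
      then show ?case by (metis Suc_eq_plus1 color.exhaust)
    qed
    with CD show "C = D" unfolding S by (intro PiE_ext[of C _ _ D]) auto
  qed
  have "card ?S = 2 ^ n"
    by (simp add: S card_PiE card_UNIV_color)
  also have "\<dots> = 2 * 2 ^ (n - 1)"
    using assms by (cases n) auto
  also have "\<dots> = card ?T"
    by (simp add: card_cartesian_product card_UNIV_color card_Pow)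
  finally have card: "card (?f ` ?S) = card ?T"
    using inj by (simp add: card_image)
  moreover have "finite ?T" using finite_UNIV_color by simp
  moreover have "?f ` ?S \<subseteq> ?T" by (auto simp: unbalanced_steps_def)
  ultimately have "?f ` ?S = ?T" by (intro card_subset_eq)
  with inj show ?thesis by (simp add: bij_betw_def)
qed

lemma balanced_edge_iff: "balanced C {i, i + 1} \<longleftrightarrow> C i \<noteq> C (i + 1)"
  unfolding balanced_def by (auto simp: doubleton_eq_iff)

lemma card_path_edges:
  "card {e \<in> edges (path_graph n). P e} = card {i \<in> {1..n - 1}. P {i, i + 1}}"
proof -
  have "{e \<in> edges (path_graph n). P e} = (\<lambda>i. {i, i + 1}) ` {i \<in> {1..n - 1}. P {i, i + 1}}"
    by (auto simp: path_graph_def)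
  moreover have "inj_on (\<lambda>i. {i, i + 1}) {i \<in> {1..n - 1}. P {i, i + 1}}"
    by (auto simp: inj_on_def doubleton_eq_iff)
  ultimately show ?thesis by (simp only: card_image)
qed

lemma mix_path: "mix (path_graph n) C = n - 1 - card (unbalanced_steps n C)"
proof -
  have "mix (path_graph n) C = card ({1..n - 1} - unbalanced_steps n C)"
    unfolding mix_def card_path_edges balanced_edge_iff unbalanced_steps_def
    by (rule arg_cong[where f = card]) auto
  also have "\<dots> = n - 1 - card (unbalanced_steps n C)"
    by (subst card_Diff_subset) (auto simp: unbalanced_steps_def)
  finally show ?thesis .
qed

lemma integrated_at_path_iff:
  "integrated_at (path_graph n) C v \<longleftrightarrow>
     card {i \<in> {1..n - 1}. i = v \<or> i + 1 = v} \<le>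
     2 * card ({i \<in> {1..n - 1}. i = v \<or> i + 1 = v} - unbalanced_steps n C)"
proof -
  have "deg (path_graph n) v = card {i \<in> {1..n - 1}. i = v \<or> i + 1 = v}"
    unfolding deg_def card_path_edges by (rule arg_cong[where f = card]) auto
  moreover have "mix_at (path_graph n) C v =
      card ({i \<in> {1..n - 1}. i = v \<or> i + 1 = v} - unbalanced_steps n C)"
    unfolding mix_at_def card_path_edges balanced_edge_iff unbalanced_steps_def
    by (rule arg_cong[where f = card]) auto
  ultimately show ?thesis
    unfolding integrated_at_def by linarith
qed

text \<open>For \<open>n \<ge> 2\<close> every degree is one or two, so "at least half of the incident edges are balanced"
  means "not all incident edges are unbalanced". At the end vertices this forbids the edges \<open>1\<close> and
  \<open>n - 1\<close> in the set of unbalanced steps, at an inner vertex it forbids two consecutive steps.\<close>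

lemma integrated_path_iff:
  assumes "n \<ge> 1"
  shows "integrated (path_graph n) C \<longleftrightarrow>
     unbalanced_steps n C \<subseteq> {2..<n - 1} \<and> nonconsecutive (unbalanced_steps n C)"
proof -
  define U where "U = unbalanced_steps n C"
  have U: "U \<subseteq> {1..n - 1}" by (auto simp: U_def unbalanced_steps_def)
  define A where "A v = {i \<in> {1..n - 1}. i = v \<or> i + 1 = v}" for v
  have int: "integrated (path_graph n) C \<longleftrightarrow> (\<forall>v\<in>{1..n}. card (A v) \<le> 2 * card (A v - U))"
    unfolding integrated_def integrated_at_path_iff U_def A_def
    by (simp only: path_graph_def fst_conv)
  show ?thesis
  proof (cases "n = 1")
    case True
    then have "U = {}" using U by simp
    moreover have "A v = {}" for v using True by (auto simp: A_def)
    ultimately show ?thesis by (simp add: int nonconsecutive_def flip: U_def)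
  next
    case False
    then have n: "n \<ge> 2" using assms by simp
    have left: "A 1 = {1}" and right: "A n = {n - 1}"
      using n by (auto simp: A_def)
    have inner: "A (Suc i) = {i, Suc i}" if "1 \<le> i" "i < n - 1" for i
      using that by (auto simp: A_def)
    have c1: "card {x} \<le> 2 * card ({x} - U) \<longleftrightarrow> x \<notin> U" for x
      by (cases "x \<in> U") (auto simp: insert_Diff_if)
    have c2: "card {x, Suc x} \<le> 2 * card ({x, Suc x} - U) \<longleftrightarrow> x \<notin> U \<or> Suc x \<notin> U" for x
      by (cases "x \<in> U"; cases "Suc x \<in> U") (auto simp: insert_Diff_if)
    have "(\<forall>v\<in>{1..n}. card (A v) \<le> 2 * card (A v - U)) \<longleftrightarrow>
        1 \<notin> U \<and> n - 1 \<notin> U \<and> (\<forall>i. 1 \<le> i \<and> i < n - 1 \<longrightarrow> i \<notin> U \<or> Suc i \<notin> U)"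
      (is "?all \<longleftrightarrow> ?cond")
    proof
      assume all: ?all
      have "1 \<in> {1..n}" "n \<in> {1..n}" using n by auto
      with all have "card (A 1) \<le> 2 * card (A 1 - U)" "card (A n) \<le> 2 * card (A n - U)"
        by blast+
      then have "1 \<notin> U" "n - 1 \<notin> U"
        unfolding left right c1 .
      moreover have "i \<notin> U \<or> Suc i \<notin> U" if "1 \<le> i" "i < n - 1" for i
      proof -
        have "Suc i \<in> {1..n}" using that by auto
        with all have "card (A (Suc i)) \<le> 2 * card (A (Suc i) - U)" by blast
        then show ?thesis unfolding inner[OF that] c2 .
      qed
      ultimately show ?cond by blast
    next
      assume cond: ?cond
      show ?all
      proof
        fix v assume v: "v \<in> {1..n}"
        consider "v = 1" | "v = n" | i where "v = Suc i" "1 \<le> i" "i < n - 1"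
        proof (cases "v = 1 \<or> v = n")
          case False
          then show ?thesis using v that(3)[of "v - 1"] by auto
        qed (use that in blast)
        then show "card (A v) \<le> 2 * card (A v - U)"
        proof cases
          case 1
          show ?thesis unfolding 1 left c1 using cond by blast
        next
          case 2
          show ?thesis unfolding 2 right c1 using cond by blast
        next
          case 3
          show ?thesis unfolding 3(1) inner[OF 3(2,3)] c2 using cond 3(2,3) by blast
        qed
      qed
    qed
    also have "\<dots> \<longleftrightarrow> U \<subseteq> {2..<n - 1} \<and> nonconsecutive U"
    proof
      assume cond: ?cond
      have "x \<in> {2..<n - 1}" if x: "x \<in> U" for x
      proof -
        have "1 \<le> x" "x \<le> n - 1" "x \<noteq> 1" "x \<noteq> n - 1" using x U cond by auto
        then show ?thesis by auto
      qed
      then have "U \<subseteq> {2..<n - 1}" by blast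
      moreover from this have "nonconsecutive U"
        unfolding nonconsecutive_def using cond by fastforce
      ultimately show "U \<subseteq> {2..<n - 1} \<and> nonconsecutive U" by blast
    qed (auto simp: nonconsecutive_def)
    finally show ?thesis using int by (simp add: U_def)
  qed
qed

text \<open>The first color is unconstrained, which is where the factor \<open>2\<close> comes from.
  The interval \<open>{2..<2 + (n - 3)}\<close> of inner edges equals \<open>{2..<n - 1}\<close> also for \<open>n < 3\<close>, where
  both are empty.\<close>

lemma card_integrated_colorings_mix_eq:
  assumes n: "n \<ge> 1" and k: "k \<le> n - 1"
  shows "card {C \<in> integrated_colorings (path_graph n). mix (path_graph n) C = k} =
           2 * card (sparse_subsets 2 (n - 3) (n - 1 - k))"
proof -
  let ?f = "\<lambda>C. (C 1, unbalanced_steps n C)"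
  let ?S = "colorings (path_graph n)"
  let ?I = "{C \<in> integrated_colorings (path_graph n). mix (path_graph n) C = k}"
  let ?Q = "sparse_subsets 2 (n - 3) (n - 1 - k)"
  have inj: "inj_on ?f ?S" and img: "?f ` ?S = UNIV \<times> Pow {1..n - 1}"
    using bij_betw_colorings_path[OF n] by (auto simp: bij_betw_def)
  have ivl: "{2..<2 + (n - 3)} = {2..<n - 1}" by auto
  have mem: "C \<in> ?I \<longleftrightarrow> C \<in> ?S \<and> unbalanced_steps n C \<in> ?Q" for C
  proof -
    have "card (unbalanced_steps n C) \<le> card {1..n - 1}"
      by (rule card_mono) (auto simp: unbalanced_steps_def)
    then have "mix (path_graph n) C = k \<longleftrightarrow> card (unbalanced_steps n C) = n - 1 - k"
      using k by (auto simp: mix_path)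
    then show ?thesis
      unfolding integrated_colorings_def sparse_subsets_def ivl
      by (auto simp: integrated_path_iff[OF n])
  qed
  have "?f ` ?I = (UNIV :: color set) \<times> ?Q"
  proof (intro equalityI subsetI)
    fix y assume "y \<in> (UNIV :: color set) \<times> ?Q"
    then obtain c U where y: "y = (c, U)" "U \<in> ?Q" by auto
    then have "U \<subseteq> {2..<n - 1}" using ivl by (simp add: sparse_subsets_def)
    also have "\<dots> \<subseteq> {1..n - 1}" by auto
    finally have "y \<in> ?f ` ?S"
      unfolding img using y(1) by simp
    then show "y \<in> ?f ` ?I" using y mem by auto
  qed (use mem in auto)
  moreover have "inj_on ?f ?I"
    using inj by (rule inj_on_subset) (use mem in blast)
  ultimately have "card ?I = card ((UNIV :: color set) \<times> ?Q)"
    by (metis (no_types, lifting) card_image)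
  then show ?thesis by (simp add: card_cartesian_product card_UNIV_color)
qed

theorem theorem4:
  fixes n k :: nat
  assumes "n \<ge> 1"
    and "\<lceil>(real n - 1) / 2\<rceil> \<le> int k" and "k \<le> n - 1"
  shows "measure_pmf.prob (pmf_of_set (integrated_colorings (path_graph n)))
           {C. mix (path_graph n) C = k}
         = 2 * ((real k - 1) gchoose (n - k - 1)) / real (ic (path_graph n))"
proof -
  let ?I = "integrated_colorings (path_graph n)"
  have "?I \<inter> {C. mix (path_graph n) C = k} = {C \<in> ?I. mix (path_graph n) C = k}"
    by blast
  then have "card (?I \<inter> {C. mix (path_graph n) C = k}) =
      2 * ((n - 3 + 1 - (n - 1 - k)) choose (n - 1 - k))"
    using card_integrated_colorings_mix_eq[OF assms(1,3)] by (simp only: card_sparse_subsets)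
  moreover have "real ((n - 3 + 1 - (n - 1 - k)) choose (n - 1 - k)) =
      (real k - 1) gchoose (n - k - 1)"
  proof (cases "n = 1")
    case True
    then show ?thesis by simp
  next
    case False
    \<comment> \<open>the lower bound on \<open>k\<close> excludes \<open>k = 0\<close>, where the upper index would be \<open>-1\<close>\<close>
    with assms have "(real n - 1) / 2 > 0" by simp
    with assms(2) have k: "k \<ge> 1" by linarith
    have "((n - 3 + 1 - (n - 1 - k)) choose (n - 1 - k)) = ((k - 1) choose (n - k - 1))"
    proof (cases "n = 2")
      case True
      then show ?thesis using k by simp
    next
      case False
      then have "n - 3 + 1 - (n - 1 - k) = k - 1" "n - 1 - k = n - k - 1"
        using \<open>n \<noteq> 1\<close> assms k by simp_all
      then show ?thesis by simp
    qed
    then show ?thesis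
      using k by (simp add: binomial_gbinomial of_nat_diff)
  qed
  moreover have "measure_pmf.prob (pmf_of_set ?I) {C. mix (path_graph n) C = k} =
      real (card (?I \<inter> {C. mix (path_graph n) C = k})) / real (card ?I)"
    by (rule measure_pmf_of_set)
      (simp_all add: integrated_colorings_path_graph_nonempty finite_integrated_colorings
        finite_graph_path_graph)
  ultimately show ?thesis by (simp add: ic_def)
qed

end
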